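(* Let $(W,S)$ be an affine Coxeter system with underlying finite Weyl group $W_0$ and let $\mathcal O\subseteq\Phi_0$ be a $W_0$-orbit. The map $\phi:\mathcal O^+\to\delta-\mathcal O^+$, $\phi(\alpha)=\delta-\alpha$, is an isomorphism of posets between $(\mathcal O^+,\le)$ and the opposite poset $(\delta-\mathcal O^+,\le)^{op}$: for any $\alpha,\beta\in\mathcal O^+$, $\alpha\le\beta$ if and only if $\delta-\beta\le\delta-\alpha$. Moreover all covering relations in $(\mathcal O^+,\le)$ and in $(\delta-\mathcal O^+,\le)$ are short.
   Context: Affine setting: $\Phi_0$ is a reduced irreducible crystallographic root system of a finite Weyl group $(W_0,S_0)$ in a Euclidean space $(V_0,B_0)$, with simple roots $\Delta_0=\{\alpha_s\mid s\in S_0\}$, positive roots $\Phi_0^+$ and highest root $\omega$. $V=V_0\oplus\mathbb R\delta$, and $B$ is the extension of $B_0$ to $V$ with radical $\mathbb R\delta$; $\|\alpha\|=\sqrt{B(\alpha,\alpha)}$. For $\beta$ with $B(\beta,\beta)\neq 0$, $s_\beta(v)=v-2\frac{B(v,\beta)}{B(\beta,\beta)}\beta$. $\Phi=\{\alpha+k\delta\mid\alpha\in\Phi_0,k\in\mathbb Z\}$, simple system $\Delta=\Delta_0\cup\{\delta-\omega\}$, $S=S_0\cup\{s_{\delta-\omega}\}$, $W=\langle S\rangle$ the affine Weyl group, with length function $\ell$; $\alpha_s$ denotes the simple root of $s\in S$. Positive roots: $\Phi^+=\{k\delta+\alpha,(k+1)\delta-\alpha\mid\alpha\in\Phi_0^+,k\in\mathbb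 N\}$, $\mathbb N=\{0,1,2,\dots\}$. Depth: $\operatorname{dp}(\beta)=\min\{\ell(w)\mid w\in W,w(\beta)\in\Delta\}$ for $\beta\in\Phi^+$. Root poset $(\Phi^+,\le)$: $\alpha\le\beta$ iff there is $w\in W$ with $w(\alpha)=\beta$ and $\ell(w)=\operatorname{dp}(\beta)-\operatorname{dp}(\alpha)$. Its covers are $\alpha\lhd s(\alpha)$ with $s\in S$, $\alpha\in\Phi^+\setminus\{\alpha_s\}$, $B(\alpha,\alpha_s)<0$. Such a cover is short if $-\|\alpha\|\|\alpha_s\|<B(\alpha,\alpha_s)<0$, and long otherwise. Subsets of $\Phi^+$ carry the induced order. For a $W_0$-orbit $\mathcal O\subseteq\Phi_0$, $\mathcal O^+=\mathcal O\cap\Phi_0^+$ and $\delta-\mathcal O^+=\{\delta-\alpha\mid\alpha\in\mathcal O^+\}$. *)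

theory Defs
  imports "HOL-Analysis.Analysis"
begin

section \<open>Reflections and the groups they generate\<close>

definition refl_form :: "('v \<Rightarrow> 'v \<Rightarrow> real) \<Rightarrow> 'v \<Rightarrow> 'v \<Rightarrow> 'v::real_vector" where
  "refl_form B \<beta> v = v - (2 * (B v \<beta> / B \<beta> \<beta>)) *\<^sub>R \<beta>"

inductive_set gen_group :: "('v \<Rightarrow> 'v) set \<Rightarrow> ('v \<Rightarrow> 'v) set" for S where
  gen_id: "id \<in> gen_group S"
| gen_incl: "s \<in> S \<Longrightarrow> s \<in> gen_group S"
| gen_inv: "w \<in> gen_group S \<Longrightarrow> inv w \<in> gen_group S"
| gen_comp: "u \<in> gen_group S \<Longrightarrow> w \<in> gen_group S \<Longrightarrow> u \<circ> w \<in> gen_group S"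

text \<open>Words use only letters of \<open>S\<close>, not their inverses; this is the usual length
  because the elements of \<open>S\<close> will be involutions.\<close>

definition word_length :: "('v \<Rightarrow> 'v) set \<Rightarrow> ('v \<Rightarrow> 'v) \<Rightarrow> nat" where
  "word_length S w = (LEAST n. \<exists>ss. set ss \<subseteq> S \<and> length ss = n \<and> foldr (\<circ>) ss id = w)"


section \<open>Finite crystallographic root systems\<close>

text \<open>The Euclidean space \<open>(V\<^sub>0, B\<^sub>0)\<close> is a type of class \<open>euclidean_space\<close> with its inner
  product.\<close>

definition crystallographic_root_system :: "'a::euclidean_space set \<Rightarrow> bool" where
  "crystallographic_root_system \<Phi>0 \<longleftrightarrow>
     finite \<Phi>0 \<and> 0 \<notin> \<Phi>0 \<and> span \<Phi>0 = UNIV \<and>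
     (\<forall>\<alpha>\<in>\<Phi>0. refl_form (\<bullet>) \<alpha> ` \<Phi>0 = \<Phi>0) \<and>
     (\<forall>\<alpha>\<in>\<Phi>0. \<forall>\<beta>\<in>\<Phi>0. 2 * (\<alpha> \<bullet> \<beta>) / (\<beta> \<bullet> \<beta>) \<in> \<int>)"

definition reduced_root_system :: "'a::euclidean_space set \<Rightarrow> bool" where
  "reduced_root_system \<Phi>0 \<longleftrightarrow> (\<forall>\<alpha>\<in>\<Phi>0. \<forall>c. c *\<^sub>R \<alpha> \<in> \<Phi>0 \<longrightarrow> c = 1 \<or> c = -1)"

definition irreducible_root_system :: "'a::euclidean_space set \<Rightarrow> bool" where
  "irreducible_root_system \<Phi>0 \<longleftrightarrow> \<Phi>0 \<noteq> {} \<and>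
     \<not> (\<exists>A B. A \<noteq> {} \<and> B \<noteq> {} \<and> A \<union> B = \<Phi>0 \<and> A \<inter> B = {} \<and> (\<forall>\<alpha>\<in>A. \<forall>\<beta>\<in>B. \<alpha> \<bullet> \<beta> = 0))"

definition nonneg_comb :: "'a::real_vector set \<Rightarrow> 'a set" where
  "nonneg_comb A = {\<Sum>a\<in>A. c a *\<^sub>R a | c. \<forall>a\<in>A. 0 \<le> c a}"

definition simple_system :: "'a::euclidean_space set \<Rightarrow> 'a set \<Rightarrow> bool" where
  "simple_system \<Phi>0 \<Delta>0 \<longleftrightarrow> \<Delta>0 \<subseteq> \<Phi>0 \<and> independent \<Delta>0 \<and>
     (\<forall>\<alpha>\<in>\<Phi>0. \<alpha> \<in> nonneg_comb \<Delta>0 \<or> - \<alpha> \<in> nonneg_comb \<Delta>0)"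

definition fin_pos_roots :: "'a::euclidean_space set \<Rightarrow> 'a set \<Rightarrow> 'a set" where
  "fin_pos_roots \<Phi>0 \<Delta>0 = \<Phi>0 \<inter> nonneg_comb \<Delta>0"

definition highest_root :: "'a::euclidean_space set \<Rightarrow> 'a set \<Rightarrow> 'a \<Rightarrow> bool" where
  "highest_root \<Phi>0 \<Delta>0 \<omega> \<longleftrightarrow> \<omega> \<in> \<Phi>0 \<and> (\<forall>\<alpha>\<in>\<Phi>0. \<omega> - \<alpha> \<in> nonneg_comb \<Delta>0)"

definition fin_weyl_group :: "'a::euclidean_space set \<Rightarrow> ('a \<Rightarrow> 'a) set" where
  "fin_weyl_group \<Delta>0 = gen_group (refl_form (\<bullet>) ` \<Delta>0)"

definition fin_weyl_orbit :: "'a::euclidean_space set \<Rightarrow> 'a \<Rightarrow> 'a set" where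
  "fin_weyl_orbit \<Delta>0 \<alpha> = {w \<alpha> | w. w \<in> fin_weyl_group \<Delta>0}"


section \<open>The affine root system\<close>

text \<open>\<open>V = V\<^sub>0 \<oplus> \<real>\<delta>\<close> is modelled as \<open>'a \<times> real\<close>, the pair \<open>(v, c)\<close> standing for
  \<open>v + c\<delta>\<close>.  The form \<open>aff_form\<close> has radical \<open>\<real>\<delta>\<close>; it is not the inner product that the
  library puts on the product type.\<close>

definition aff_form :: "'a::euclidean_space \<times> real \<Rightarrow> 'a \<times> real \<Rightarrow> real" where
  "aff_form x y = fst x \<bullet> fst y"

definition aff_norm :: "'a::euclidean_space \<times> real \<Rightarrow> real" where
  "aff_norm x = sqrt (aff_form x x)"

definition fin_emb :: "'a::euclidean_space \<Rightarrow> 'a \<times> real" where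
  "fin_emb v = (v, 0)"

definition delta :: "'a::euclidean_space \<times> real" where
  "delta = (0, 1)"

definition aff_simple :: "'a::euclidean_space set \<Rightarrow> 'a \<Rightarrow> ('a \<times> real) set" where
  "aff_simple \<Delta>0 \<omega> = fin_emb ` \<Delta>0 \<union> {delta - fin_emb \<omega>}"

definition aff_pos_roots :: "'a::euclidean_space set \<Rightarrow> 'a set \<Rightarrow> ('a \<times> real) set" where
  "aff_pos_roots \<Phi>0 \<Delta>0 =
     {real k *\<^sub>R delta + fin_emb \<alpha> | k \<alpha>. \<alpha> \<in> fin_pos_roots \<Phi>0 \<Delta>0} \<union>
     {real (k + 1) *\<^sub>R delta - fin_emb \<alpha> | k \<alpha>. \<alpha> \<in> fin_pos_roots \<Phi>0 \<Delta>0}"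

definition aff_refls :: "'a::euclidean_space set \<Rightarrow> 'a \<Rightarrow> ('a \<times> real \<Rightarrow> 'a \<times> real) set" where
  "aff_refls \<Delta>0 \<omega> = refl_form aff_form ` aff_simple \<Delta>0 \<omega>"

definition aff_weyl_group :: "'a::euclidean_space set \<Rightarrow> 'a \<Rightarrow> ('a \<times> real \<Rightarrow> 'a \<times> real) set" where
  "aff_weyl_group \<Delta>0 \<omega> = gen_group (aff_refls \<Delta>0 \<omega>)"

definition aff_length :: "'a::euclidean_space set \<Rightarrow> 'a \<Rightarrow> ('a \<times> real \<Rightarrow> 'a \<times> real) \<Rightarrow> nat" where
  "aff_length \<Delta>0 \<omega> = word_length (aff_refls \<Delta>0 \<omega>)"


section \<open>Depth and the root poset\<close>

definition depth :: "'a::euclidean_space set \<Rightarrow> 'a \<Rightarrow> 'a \<times> real \<Rightarrow> nat" where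
  "depth \<Delta>0 \<omega> \<beta> =
     (LEAST n. \<exists>w\<in>aff_weyl_group \<Delta>0 \<omega>. w \<beta> \<in> aff_simple \<Delta>0 \<omega> \<and> aff_length \<Delta>0 \<omega> w = n)"

definition root_le ::
  "'a::euclidean_space set \<Rightarrow> 'a set \<Rightarrow> 'a \<Rightarrow> 'a \<times> real \<Rightarrow> 'a \<times> real \<Rightarrow> bool" where
  "root_le \<Phi>0 \<Delta>0 \<omega> \<alpha> \<beta> \<longleftrightarrow>
     \<alpha> \<in> aff_pos_roots \<Phi>0 \<Delta>0 \<and> \<beta> \<in> aff_pos_roots \<Phi>0 \<Delta>0 \<and>
     (\<exists>w\<in>aff_weyl_group \<Delta>0 \<omega>. w \<alpha> = \<beta> \<and>
        int (aff_length \<Delta>0 \<omega> w) = int (depth \<Delta>0 \<omega> \<beta>) - int (depth \<Delta>0 \<omega> \<alpha>))"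

text \<open>\<open>covers_in le X x y\<close>: \<open>y\<close> covers \<open>x\<close> in the order induced by \<open>le\<close> on \<open>X\<close>.\<close>

definition covers_in :: "('b \<Rightarrow> 'b \<Rightarrow> bool) \<Rightarrow> 'b set \<Rightarrow> 'b \<Rightarrow> 'b \<Rightarrow> bool" where
  "covers_in le X x y \<longleftrightarrow> x \<in> X \<and> y \<in> X \<and> le x y \<and> x \<noteq> y \<and>
     (\<forall>z\<in>X. le x z \<and> le z y \<longrightarrow> z = x \<or> z = y)"

definition short_cover ::
  "'a::euclidean_space set \<Rightarrow> 'a set \<Rightarrow> 'a \<Rightarrow> 'a \<times> real \<Rightarrow> 'a \<times> real \<Rightarrow> bool" where
  "short_cover \<Phi>0 \<Delta>0 \<omega> \<alpha> \<beta> \<longleftrightarrow>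
     covers_in (root_le \<Phi>0 \<Delta>0 \<omega>) (aff_pos_roots \<Phi>0 \<Delta>0) \<alpha> \<beta> \<and>
     (\<exists>a\<in>aff_simple \<Delta>0 \<omega>. \<alpha> \<noteq> a \<and> \<beta> = refl_form aff_form a \<alpha> \<and>
        - (aff_norm \<alpha> * aff_norm a) < aff_form \<alpha> a \<and> aff_form \<alpha> a < 0)"

text \<open>\<open>\<O>\<^sup>+\<close>, viewed inside \<open>V\<close>.\<close>

definition orbit_pos ::
  "'a::euclidean_space set \<Rightarrow> 'a set \<Rightarrow> 'a set \<Rightarrow> ('a \<times> real) set" where
  "orbit_pos \<Phi>0 \<Delta>0 \<O> = fin_emb ` (\<O> \<inter> fin_pos_roots \<Phi>0 \<Delta>0)"

end

theory Submission
  imports Defs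
begin

text \<open>The reflection in a positive root \<open>\<beta>\<close> has \<open>2 dp(\<beta>) + 1\<close> inversions, so a simple reflection
  \<open>s\<^sub>a\<close> with \<open>\<beta> \<noteq> a\<close> changes the depth of \<open>\<beta>\<close> by \<open>- sgn B(\<beta>, a)\<close>.  Hence \<open>\<alpha> \<le> \<beta>\<close> holds iff \<open>\<beta>\<close> is
  reached from \<open>\<alpha>\<close> by steps \<open>\<gamma> \<mapsto> s\<^sub>a(\<gamma>)\<close> with \<open>B(\<gamma>, a) < 0\<close>.  The \<open>\<delta>\<close>-coefficient never decreases along
  such a chain and strictly increases at each use of the affine reflection; a chain between roots
  with equal \<open>\<delta>\<close>-coefficient thus uses only reflections in \<open>\<Delta>0\<close>, and
  \<open>\<gamma> \<mapsto> \<delta> - \<gamma>\<close> reverses it.  A step along \<open>a\<close> could only be long when \<open>\<gamma> = k\<delta> - a\<close>; such a step goes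
  from a negative finite root to a positive one, so it joins neither two elements of
  \<open>\<O>\<^sup>+\<close> nor two of \<open>\<delta> - \<O>\<^sup>+\<close>.\<close>

section \<open>Words in a generating set and nonnegative combinations\<close>

definition word :: "('v \<Rightarrow> 'v) list \<Rightarrow> 'v \<Rightarrow> 'v" where
  "word ss = foldr (\<circ>) ss id"

lemma word_simps [simp]: "word [] = id" "word (s # ss) = s \<circ> word ss"
  by (simp_all add: word_def)

lemma word_append: "word (ss @ ts) = word ss \<circ> word ts"
  by (induction ss) (auto simp: comp_assoc)

lemma word_length_eq: "word_length S w = (LEAST n. \<exists>ss. set ss \<subseteq> S \<and> length ss = n \<and> word ss = w)"
  by (simp add: word_length_def word_def)

lemma word_in_gen_group:
  "set ss \<subseteq> S \<Longrightarrow> word ss \<in> gen_group S"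
  by (induction ss) (auto intro: gen_group.intros)

text \<open>\<open>gen_group\<close> admits inverses while \<open>word_length\<close> counts letters
  only. For involutions the inverse of a word is its reversal, since equal neighbours cancel from
  the middle outwards.\<close>

lemma gen_group_word:
  assumes invol: "\<And>s. s \<in> S \<Longrightarrow> s \<circ> s = id" and "w \<in> gen_group S"
  shows "\<exists>ss. set ss \<subseteq> S \<and> word ss = w"
  using assms(2)
proof induction
  case gen_id
  then show ?case by (intro exI[of _ "[]"]) auto
next
  case (gen_incl s)
  then show ?case by (intro exI[of _ "[s]"]) auto
next
  case (gen_inv w)
  then obtain ss where ss: "set ss \<subseteq> S" "word ss = w" by blast
  have cancel: "word ts \<circ> word (rev ts) = id" if "set ts \<subseteq> S" for ts
    using that
  proof (induction ts)
    case (Cons t ts)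
    have "word (t # ts) \<circ> word (rev (t # ts))
        = t \<circ> (word ts \<circ> word (rev ts)) \<circ> t"
      by (simp add: word_append comp_assoc)
    also have "word ts \<circ> word (rev ts) = id" by (rule Cons.IH) (use Cons.prems in simp)
    also have "t \<circ> id \<circ> t = id" using Cons.prems invol by simp
    finally show ?case .
  qed simp
  have "w \<circ> word (rev ss) = id" "word (rev ss) \<circ> w = id"
    using cancel[of ss] cancel[of "rev ss"] ss by auto
  then have "inv w = word (rev ss)"
    by (metis inv_unique_comp)
  then show ?case using ss by (intro exI[of _ "rev ss"]) auto
next
  case (gen_comp u w)
  then obtain ss ts where "set ss \<subseteq> S" "word ss = u" "set ts \<subseteq> S" "word ts = w"
    by blast
  then show ?case by (intro exI[of _ "ss @ ts"]) (auto simp: word_append)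
qed

lemma word_length_le:
  "set ss \<subseteq> S \<Longrightarrow> word_length S (word ss) \<le> length ss"
  unfolding word_length_eq by (rule Least_le) blast

text \<open>The existence of some word is what makes the \<open>LEAST\<close> in
  \<open>word_length\<close> attained.\<close>

lemma word_length_witness:
  assumes "\<And>s. s \<in> S \<Longrightarrow> s \<circ> s = id" and "w \<in> gen_group S"
  obtains ss where "set ss \<subseteq> S" "length ss = word_length S w" "word ss = w"
proof -
  have "\<exists>n ss. set ss \<subseteq> S \<and> length ss = n \<and> word ss = w"
    using gen_group_word[OF assms] by blast
  from LeastI_ex[OF this] show ?thesis
    using that unfolding word_length_eq by blast
qed

section \<open>Cones of nonnegative combinations\<close>

lemma nonneg_comb_add:
  assumes "x \<in> nonneg_comb A" "y \<in> nonneg_comb A"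
  shows "x + y \<in> nonneg_comb A"
proof -
  from assms obtain c d where "x = (\<Sum>a\<in>A. c a *\<^sub>R a)" "\<forall>a\<in>A. 0 \<le> c a"
    "y = (\<Sum>a\<in>A. d a *\<^sub>R a)" "\<forall>a\<in>A. 0 \<le> d a"
    unfolding nonneg_comb_def by blast
  then have "x + y = (\<Sum>a\<in>A. (c a + d a) *\<^sub>R a)" "\<forall>a\<in>A. 0 \<le> c a + d a"
    by (auto simp: scaleR_add_left sum.distrib)
  then show ?thesis unfolding nonneg_comb_def by (blast intro: exI[of _ "\<lambda>a. c a + d a"])
qed

lemma nonneg_comb_scale:
  assumes "x \<in> nonneg_comb A" "0 \<le> t"
  shows "t *\<^sub>R x \<in> nonneg_comb A"
proof -
  from assms obtain c where "x = (\<Sum>a\<in>A. c a *\<^sub>R a)" "\<forall>a\<in>A. 0 \<le> c a"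
    unfolding nonneg_comb_def by blast
  then have "t *\<^sub>R x = (\<Sum>a\<in>A. (t * c a) *\<^sub>R a)" "\<forall>a\<in>A. 0 \<le> t * c a"
    using assms(2) by (auto simp: scaleR_sum_right)
  then show ?thesis unfolding nonneg_comb_def by (blast intro: exI[of _ "\<lambda>a. t * c a"])
qed

text \<open>Splits off the coefficient of one generator; later this is the affine simple root
  \<delta> - \<omega>.\<close>

lemma nonneg_comb_insert:
  assumes "finite A" "a \<notin> A"
  shows "x \<in> nonneg_comb (insert a A) \<longleftrightarrow> (\<exists>t\<ge>0. x - t *\<^sub>R a \<in> nonneg_comb A)"
proof
  assume "x \<in> nonneg_comb (insert a A)"
  then obtain c where c: "x = (\<Sum>b\<in>insert a A. c b *\<^sub>R b)" "\<forall>b\<in>insert a A. 0 \<le> c b"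
    unfolding nonneg_comb_def by blast
  then have "x - c a *\<^sub>R a = (\<Sum>b\<in>A. c b *\<^sub>R b)" using assms by simp
  with c(2) show "\<exists>t\<ge>0. x - t *\<^sub>R a \<in> nonneg_comb A"
    unfolding nonneg_comb_def by blast
next
  assume "\<exists>t\<ge>0. x - t *\<^sub>R a \<in> nonneg_comb A"
  then obtain t c where t: "t \<ge> 0" and c: "x - t *\<^sub>R a = (\<Sum>b\<in>A. c b *\<^sub>R b)" "\<forall>b\<in>A. 0 \<le> c b"
    unfolding nonneg_comb_def by blast
  let ?c = "c(a := t)"
  have "(\<Sum>b\<in>A. ?c b *\<^sub>R b) = (\<Sum>b\<in>A. c b *\<^sub>R b)"
    using assms by (intro sum.cong) auto
  then have "x = (\<Sum>b\<in>insert a A. ?c b *\<^sub>R b)"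
    using assms c(1) by (simp add: algebra_simps)
  moreover have "\<forall>b\<in>insert a A. 0 \<le> ?c b" using t c(2) by auto
  ultimately show "x \<in> nonneg_comb (insert a A)" unfolding nonneg_comb_def by blast
qed

lemma nonneg_comb_linear_image:
  assumes "linear f" "inj f"
  shows "nonneg_comb (f ` A) = f ` nonneg_comb A"
proof (intro set_eqI iffI)
  have inj: "inj_on f A" using assms(2) by (rule inj_on_subset) simp
  have im: "(\<Sum>b\<in>f ` A. c b *\<^sub>R b) = f (\<Sum>a\<in>A. c (f a) *\<^sub>R a)" for c
    by (simp add: sum.reindex[OF inj] linear_sum[OF assms(1)] linear_scale[OF assms(1)])
  show "x \<in> f ` nonneg_comb A" if x: "x \<in> nonneg_comb (f ` A)" for x
  proof -
    from x obtain c where c: "x = (\<Sum>b\<in>f ` A. c b *\<^sub>R b)" "\<forall>b\<in>f ` A. 0 \<le> c b"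
      unfolding nonneg_comb_def by blast
    have "(\<Sum>a\<in>A. c (f a) *\<^sub>R a) \<in> nonneg_comb A"
      using c(2) unfolding nonneg_comb_def by (intro CollectI exI[of _ "\<lambda>a. c (f a)"]) auto
    then show ?thesis unfolding c(1) im by (rule imageI)
  qed
  show "x \<in> nonneg_comb (f ` A)" if x: "x \<in> f ` nonneg_comb A" for x
  proof -
    from x obtain c where c: "x = f (\<Sum>a\<in>A. c a *\<^sub>R a)" "\<forall>a\<in>A. 0 \<le> c a"
      unfolding nonneg_comb_def by blast
    have "x = (\<Sum>b\<in>f ` A. c (inv f b) *\<^sub>R b)"
      unfolding c(1) im using assms(2) by simp
    then show ?thesis
      using c(2) assms(2) unfolding nonneg_comb_def
      by (intro CollectI exI[of _ "\<lambda>b. c (inv f b)"]) auto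
  qed
qed

text \<open>Independence makes the existentially quantified coefficients unique, so positivity can
  be tested coordinate by coordinate.\<close>

lemma nonneg_comb_iff_representation:
  assumes "finite A" "independent A"
  shows "x \<in> nonneg_comb A \<longleftrightarrow> x \<in> span A \<and> (\<forall>a\<in>A. 0 \<le> representation A x a)"
proof
  assume "x \<in> nonneg_comb A"
  then obtain c where c: "x = (\<Sum>a\<in>A. c a *\<^sub>R a)" "\<forall>a\<in>A. 0 \<le> c a"
    unfolding nonneg_comb_def by blast
  have sp: "x \<in> span A" unfolding c(1) by (intro span_sum span_scale span_base)
  have "representation A x a = c a" if "a \<in> A" for a
  proof -
    have "representation A x a = (\<Sum>b\<in>A. c b * representation A b a)"
      unfolding c(1) using assms(2)
      by (simp add: representation_sum representation_scale span_base span_scale)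
    also have "\<dots> = (\<Sum>b\<in>A. if b = a then c b else 0)"
      using assms(2) by (intro sum.cong) (auto simp: representation_basis)
    also have "\<dots> = c a" using that assms(1) by simp
    finally show ?thesis .
  qed
  with c sp show "x \<in> span A \<and> (\<forall>a\<in>A. 0 \<le> representation A x a)" by simp
next
  assume "x \<in> span A \<and> (\<forall>a\<in>A. 0 \<le> representation A x a)"
  then show "x \<in> nonneg_comb A"
    using sum_representation_eq[OF assms(2) _ assms(1), of x] unfolding nonneg_comb_def by force
qed

section \<open>Depth in a based root system\<close>

text \<open>Positivity of \<open>B\<close> is asked on roots only, which admits a form with a
  radical, and \<open>\<Phi>\<close> may be infinite; \<open>fin_inversions\<close> supplies the
  finiteness on which counting inversions rests.\<close>

locale root_basis =
  fixes B :: "'v::real_vector \<Rightarrow> 'v \<Rightarrow> real" and \<Phi> \<Delta> :: "'v set"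
  assumes B_sym: "B x y = B y x"
    and B_add: "B (x + y) z = B x z + B y z"
    and B_scale: "B (t *\<^sub>R x) z = t * B x z"
    and B_pos: "\<beta> \<in> \<Phi> \<Longrightarrow> 0 < B \<beta> \<beta>"
    and fin_simple: "finite \<Delta>"
    and indep_simple: "independent \<Delta>"
    and simple_roots: "\<Delta> \<subseteq> \<Phi>"
    and refl_root: "\<beta> \<in> \<Phi> \<Longrightarrow> \<gamma> \<in> \<Phi> \<Longrightarrow> refl_form B \<beta> \<gamma> \<in> \<Phi>"
    and root_sign: "\<beta> \<in> \<Phi> \<Longrightarrow> \<beta> \<in> nonneg_comb \<Delta> \<or> - \<beta> \<in> nonneg_comb \<Delta>"
    and root_reduced: "\<beta> \<in> \<Phi> \<Longrightarrow> t *\<^sub>R \<beta> \<in> \<Phi> \<Longrightarrow> t = 1 \<or> t = -1"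
    and fin_inversions: "\<beta> \<in> \<Phi> \<Longrightarrow> finite {\<gamma> \<in> \<Phi> \<inter> nonneg_comb \<Delta>. refl_form B \<beta> \<gamma> \<notin> nonneg_comb \<Delta>}"
begin

abbreviation pos :: "'v set" where "pos \<equiv> \<Phi> \<inter> nonneg_comb \<Delta>"

abbreviation refl :: "'v \<Rightarrow> 'v \<Rightarrow> 'v" where "refl \<equiv> refl_form B"

abbreviation coeff :: "'v \<Rightarrow> 'v \<Rightarrow> real" where "coeff \<equiv> representation \<Delta>"

text \<open>The inversion set of the reflection in \<open>\<beta>\<close>, indexed by the root
  rather than by the group element.\<close>

definition inversions :: "'v \<Rightarrow> 'v set" where
  "inversions \<beta> = {\<gamma> \<in> pos. refl \<beta> \<gamma> \<notin> nonneg_comb \<Delta>}"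

definition dp :: "'v \<Rightarrow> nat" where
  "dp \<beta> = (LEAST n. \<exists>w\<in>gen_group (refl ` \<Delta>). w \<beta> \<in> \<Delta> \<and> word_length (refl ` \<Delta>) w = n)"

text \<open>With this extension to negative roots, a simple reflection \<open>s\<^sub>a\<close> changes the value at
  \<open>\<beta>\<close> by \<open>- sgn (B \<beta> a)\<close> without exception, also when it turns \<open>a\<close> into \<open>- a\<close>.  Words whose
  intermediate roots become negative therefore need no separate treatment.\<close>

definition signed_depth :: "'v \<Rightarrow> int" where
  "signed_depth \<beta> = (if \<beta> \<in> nonneg_comb \<Delta> then int (dp \<beta>) else - 1 - int (dp (- \<beta>)))"

text \<open>The cover condition of the root poset. For a root \<open>a\<close> the sign condition
  also excludes \<open>x = a\<close>, because \<open>B a a\<close> is positive.\<close>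

definition up :: "'v \<Rightarrow> 'v \<Rightarrow> bool" where
  "up x y \<longleftrightarrow> (\<exists>a\<in>\<Delta>. B x a < 0 \<and> y = refl a x)"

section \<open>Algebra of the form and its reflections\<close>

lemma B_minus: "B (- x) y = - B x y"
  using B_scale[of "- 1" x y] by simp

lemma B_diff: "B (x - y) z = B x z - B y z"
  using B_add[of x "- y" z] by (simp add: B_minus)

lemma B_add_right: "B z (x + y) = B z x + B z y"
  using B_add B_sym by metis

lemma B_scale_right: "B z (t *\<^sub>R x) = t * B z x"
  using B_scale B_sym by metis

lemma B_diff_right: "B z (x - y) = B z x - B z y"
  using B_diff B_sym by metis

lemmas B_bilinear = B_add B_scale B_minus B_diff B_add_right B_scale_right B_diff_right

lemma refl_self: "\<beta> \<in> \<Phi> \<Longrightarrow> refl \<beta> \<beta> = - \<beta>"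
  using B_pos[of \<beta>] by (simp add: refl_form_def scaleR_2)

lemma refl_minus: "refl \<beta> (- x) = - refl \<beta> x"
  by (simp add: refl_form_def B_minus)

lemma refl_refl: "\<beta> \<in> \<Phi> \<Longrightarrow> refl \<beta> (refl \<beta> x) = x"
  using B_pos[of \<beta>] by (simp add: refl_form_def B_bilinear algebra_simps)

lemma B_refl: "\<beta> \<in> \<Phi> \<Longrightarrow> B (refl \<beta> x) (refl \<beta> y) = B x y"
  using B_pos[of \<beta>] B_sym[of \<beta> y]
  by (simp add: refl_form_def B_bilinear algebra_simps)

lemma B_refl_simple: "\<beta> \<in> \<Phi> \<Longrightarrow> B (refl \<beta> x) \<beta> = - B x \<beta>"
  using B_pos[of \<beta>] by (simp add: refl_form_def B_bilinear)

text \<open>\<open>refl a\<close> is a linear isometry, so conjugating a reflection by it gives the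
  reflection in the image root.\<close>

lemma refl_conj:
  assumes "a \<in> \<Phi>"
  shows "refl (refl a \<beta>) (refl a x) = refl a (refl \<beta> x)"
proof -
  have "refl a (u - t *\<^sub>R v) = refl a u - t *\<^sub>R refl a v" for u v t
    by (simp add: refl_form_def B_bilinear algebra_simps diff_divide_distrib)
  then show ?thesis
    by (simp add: refl_form_def[of B "refl a \<beta>"] refl_form_def[of B \<beta>] B_refl[OF assms])
qed

section \<open>Signs and coordinates of roots\<close>

lemma root_minus: "\<beta> \<in> \<Phi> \<Longrightarrow> - \<beta> \<in> \<Phi>"
  using refl_root[of \<beta> \<beta>] refl_self by simp

lemma root_nonzero: "\<beta> \<in> \<Phi> \<Longrightarrow> \<beta> \<noteq> 0"
  using B_pos B_scale[of 0 0 0] by force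

lemma root_span: "\<beta> \<in> \<Phi> \<Longrightarrow> \<beta> \<in> span \<Delta>"
  using root_sign nonneg_comb_iff_representation[OF fin_simple indep_simple] span_neg minus_minus by metis

lemma positive_coeff: "\<beta> \<in> pos \<Longrightarrow> b \<in> \<Delta> \<Longrightarrow> 0 \<le> coeff \<beta> b"
  using nonneg_comb_iff_representation[OF fin_simple indep_simple] by blast

lemma coeff_minus: "\<beta> \<in> \<Phi> \<Longrightarrow> coeff (- \<beta>) b = - coeff \<beta> b"
  by (simp add: representation_neg[OF indep_simple root_span])

lemma coeff_refl:
  assumes "\<beta> \<in> \<Phi>" "\<gamma> \<in> \<Phi>"
  shows "coeff (refl \<beta> \<gamma>) b = coeff \<gamma> b - 2 * (B \<gamma> \<beta> / B \<beta> \<beta>) * coeff \<beta> b"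
  using assms indep_simple
  by (simp add: refl_form_def representation_diff representation_scale root_span span_scale)

lemma coeff_simple: "a \<in> \<Delta> \<Longrightarrow> coeff a b = (if b = a then 1 else 0)"
  by (simp add: representation_basis[OF indep_simple])

lemma root_eq_sum: "\<beta> \<in> \<Phi> \<Longrightarrow> (\<Sum>b\<in>\<Delta>. coeff \<beta> b *\<^sub>R b) = \<beta>"
  using sum_representation_eq[OF indep_simple root_span fin_simple] by simp

text \<open>The coordinates of a root all have the same weak sign, so a single positive one
  decides.\<close>

lemma root_positive_if_coeff: "\<gamma> \<in> \<Phi> \<Longrightarrow> b \<in> \<Delta> \<Longrightarrow> 0 < coeff \<gamma> b \<Longrightarrow> \<gamma> \<in> pos"
  using root_sign[of \<gamma>] positive_coeff[of "- \<gamma>" b] root_minus coeff_minus by fastforce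

lemma simple_positive: "a \<in> \<Delta> \<Longrightarrow> a \<in> pos"
  using simple_roots by (intro root_positive_if_coeff[of _ a]) (auto simp: coeff_simple)

text \<open>If both signs occurred, all coordinates would vanish and the root would be zero.\<close>

lemma not_positive_iff: "\<beta> \<in> \<Phi> \<Longrightarrow> \<beta> \<notin> nonneg_comb \<Delta> \<longleftrightarrow> - \<beta> \<in> nonneg_comb \<Delta>"
proof -
  assume \<beta>: "\<beta> \<in> \<Phi>"
  have "False" if "\<beta> \<in> nonneg_comb \<Delta>" "- \<beta> \<in> nonneg_comb \<Delta>"
  proof -
    have "coeff \<beta> b = 0" if b: "b \<in> \<Delta>" for b
      using positive_coeff[of \<beta> b] positive_coeff[of "- \<beta>" b] \<beta> \<open>\<beta> \<in> nonneg_comb \<Delta>\<close> \<open>- \<beta> \<in> _\<close> b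
        root_minus coeff_minus by fastforce
    then have "\<beta> = 0" using root_eq_sum[OF \<beta>] by simp
    then show False using root_nonzero \<beta> by blast
  qed
  then show ?thesis using root_sign[OF \<beta>] by blast
qed

text \<open>Otherwise \<open>\<beta>\<close> would be a multiple of \<open>a\<close>; reducedness
  leaves \<open>a\<close> and \<open>- a\<close>, and positivity rules out
  \<open>- a\<close>.\<close>

lemma other_coeff:
  assumes "\<beta> \<in> pos" "a \<in> \<Delta>" "\<beta> \<noteq> a"
  obtains b where "b \<in> \<Delta>" "b \<noteq> a" "0 < coeff \<beta> b"
proof (rule ccontr)
  note goal = that
  assume not: "\<not> thesis"
  have z: "coeff \<beta> b = 0" if "b \<in> \<Delta>" "b \<noteq> a" for b
    using goal[OF that] not positive_coeff[OF assms(1) that(1)] by linarith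
  have "\<beta> = (\<Sum>b\<in>\<Delta>. if b = a then coeff \<beta> a *\<^sub>R a else 0)"
    using root_eq_sum[of \<beta>] assms(1) z by (subst sum.cong[OF refl, of _ _ "\<lambda>b. coeff \<beta> b *\<^sub>R b"]) auto
  then have e: "\<beta> = coeff \<beta> a *\<^sub>R a" using assms(2) fin_simple by simp
  then have "coeff \<beta> a = 1 \<or> coeff \<beta> a = -1"
    using root_reduced[of a "coeff \<beta> a"] assms simple_roots by auto
  moreover have "coeff \<beta> a \<ge> 0" using assms positive_coeff by blast
  ultimately show False using e assms(3) by auto
qed

text \<open>\<open>refl a\<close> alters only the coordinate at \<open>a\<close>, so a positive
  coordinate elsewhere survives.\<close>

lemma refl_simple_positive:
  assumes "\<beta> \<in> pos" "a \<in> \<Delta>" "\<beta> \<noteq> a"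
  shows "refl a \<beta> \<in> pos"
proof -
  obtain b where b: "b \<in> \<Delta>" "b \<noteq> a" "0 < coeff \<beta> b" using other_coeff[OF assms] .
  have "coeff (refl a \<beta>) b = coeff \<beta> b"
    using coeff_refl[of a \<beta> b] assms simple_roots b coeff_simple by auto
  then show ?thesis
    using root_positive_if_coeff[of "refl a \<beta>" b] refl_root[of a \<beta>] assms simple_roots b by auto
qed

text \<open>If \<open>s\<^sub>a\<close> is a descent of \<open>\<beta>\<close>, the inversions \<open>a\<close> and \<open>- s\<^sub>\<beta> a\<close> of \<open>s\<^sub>\<beta>\<close> disappear, and
  \<open>s\<^sub>a\<close> carries the others to the inversions of the conjugate reflection \<open>s\<^sub>a s\<^sub>\<beta> s\<^sub>a\<close>.\<close>

lemma card_inversions_refl: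
  assumes \<beta>: "\<beta> \<in> pos" and a: "a \<in> \<Delta>" "\<beta> \<noteq> a" and gt: "0 < B \<beta> a"
  shows "card (inversions \<beta>) = card (inversions (refl a \<beta>)) + 2"
proof -
  have \<beta>\<Phi>: "\<beta> \<in> \<Phi>" and a\<Phi>: "a \<in> \<Phi>" and apos: "a \<in> pos"
    using \<beta> a simple_roots simple_positive by auto
  obtain b where b: "b \<in> \<Delta>" "b \<noteq> a" "0 < coeff \<beta> b" using other_coeff[OF \<beta> a] .
  define \<gamma> where "\<gamma> = - refl \<beta> a"
  have \<gamma>\<Phi>: "\<gamma> \<in> \<Phi>" unfolding \<gamma>_def by (intro root_minus refl_root \<beta>\<Phi> a\<Phi>)
  \<comment> \<open>As \<open>a\<close> has no coordinate at \<open>b\<close>, that of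
    \<open>\<gamma>\<close> is a multiple of that of \<open>\<beta>\<close>, with the sign of
    \<open>B \<beta> a\<close>. This makes \<open>\<gamma>\<close> positive and different from
    \<open>a\<close>.\<close>
  have "coeff \<gamma> b = 2 * (B a \<beta> / B \<beta> \<beta>) * coeff \<beta> b"
    unfolding \<gamma>_def using coeff_minus[OF refl_root[OF \<beta>\<Phi> a\<Phi>]] coeff_refl[OF \<beta>\<Phi> a\<Phi>] coeff_simple a b
    by simp
  then have cg: "0 < coeff \<gamma> b" using b gt B_pos[OF \<beta>\<Phi>] B_sym[of a \<beta>] by simp
  have \<gamma>pos: "\<gamma> \<in> pos" using root_positive_if_coeff[OF \<gamma>\<Phi> b(1) cg] .
  have \<gamma>a: "\<gamma> \<noteq> a" using cg coeff_simple[OF a(1), of b] b by auto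
  have r\<gamma>: "refl \<beta> \<gamma> = - a" unfolding \<gamma>_def by (simp add: refl_minus refl_refl[OF \<beta>\<Phi>])
  have ra: "refl \<beta> a = - \<gamma>" by (simp add: \<gamma>_def)
  have neg: "- x \<notin> nonneg_comb \<Delta>" if "x \<in> pos" for x
    using that not_positive_iff root_minus by blast
  have mem: "a \<in> inversions \<beta>" "\<gamma> \<in> inversions \<beta>"
    unfolding inversions_def using apos \<gamma>pos r\<gamma> ra neg by auto
  have "bij_betw (refl a) (inversions \<beta> - {a, \<gamma>}) (inversions (refl a \<beta>))"
  proof (rule bij_betw_byWitness[where f' = "refl a"])
    show "\<forall>x\<in>inversions \<beta> - {a, \<gamma>}. refl a (refl a x) = x"
      "\<forall>x\<in>inversions (refl a \<beta>). refl a (refl a x) = x"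
      by (auto simp: refl_refl[OF a\<Phi>])
    show "refl a ` (inversions \<beta> - {a, \<gamma>}) \<subseteq> inversions (refl a \<beta>)"
    proof (rule image_subsetI)
      fix x assume x: "x \<in> inversions \<beta> - {a, \<gamma>}"
      then have xp: "x \<in> pos" "refl \<beta> x \<notin> nonneg_comb \<Delta>" by (auto simp: inversions_def)
      then have m: "- refl \<beta> x \<in> pos"
        using not_positive_iff refl_root[OF \<beta>\<Phi>] root_minus by blast
      \<comment> \<open>Equality would mean \<open>x = \<gamma>\<close>, which was removed.\<close>
      have "- refl \<beta> x \<noteq> a"
        using x ra refl_refl[OF \<beta>\<Phi>, of x] refl_minus[of \<beta> "refl \<beta> x"] by auto
      then have "- refl a (refl \<beta> x) \<in> pos"
        using refl_simple_positive[OF m a(1)] by (simp add: refl_minus)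
      then have "refl a (refl \<beta> x) \<notin> nonneg_comb \<Delta>" using neg by fastforce
      then show "refl a x \<in> inversions (refl a \<beta>)"
        unfolding inversions_def using refl_conj[OF a\<Phi>] refl_simple_positive[OF xp(1) a(1)] x by auto
    qed
    show "refl a ` inversions (refl a \<beta>) \<subseteq> inversions \<beta> - {a, \<gamma>}"
    proof (rule image_subsetI)
      fix x assume "x \<in> inversions (refl a \<beta>)"
      then have xp: "x \<in> pos" and n: "refl (refl a \<beta>) x \<notin> nonneg_comb \<Delta>"
        by (auto simp: inversions_def)
      have e: "refl (refl a \<beta>) x = refl a (refl \<beta> (refl a x))"
        using refl_conj[OF a\<Phi>, of \<beta> "refl a x"] refl_refl[OF a\<Phi>] by simp
      \<comment> \<open>The conjugate reflection sends \<open>a\<close> to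
        \<open>refl a \<gamma>\<close>, which is positive, so \<open>a\<close> is not one of its
        inversions.\<close>
      have xa: "x \<noteq> a"
      proof
        assume "x = a"
        then have "refl (refl a \<beta>) x = refl a \<gamma>"
          unfolding e by (simp add: refl_self[OF a\<Phi>] refl_minus ra)
        then show False using n refl_simple_positive[OF \<gamma>pos a(1) \<gamma>a] by simp
      qed
      have yp: "refl a x \<in> pos" using refl_simple_positive[OF xp a(1) xa] .
      have "refl a x \<noteq> a"
        using refl_refl[OF a\<Phi>, of x] refl_self[OF a\<Phi>] neg[OF apos] xp by auto
      \<comment> \<open>The conjugate reflection sends \<open>refl a \<gamma>\<close> to the
        positive root \<open>a\<close>.\<close>
      moreover have "refl a x \<noteq> \<gamma>"
      proof
        assume "refl a x = \<gamma>"
        then have "refl (refl a \<beta>) x = a"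
          unfolding e by (simp add: r\<gamma> refl_minus refl_self[OF a\<Phi>])
        then show False using n apos by simp
      qed
      moreover have "refl \<beta> (refl a x) \<notin> nonneg_comb \<Delta>"
      proof
        assume "refl \<beta> (refl a x) \<in> nonneg_comb \<Delta>"
        then have p: "refl \<beta> (refl a x) \<in> pos" using refl_root[OF \<beta>\<Phi>] yp by blast
        \<comment> \<open>\<open>refl a\<close> makes this positive root negative, which singles out
          \<open>a\<close>.\<close>
        then have "refl \<beta> (refl a x) = a"
          using refl_simple_positive[OF p a(1)] n e by auto
        then have "refl a x = - \<gamma>" using ra refl_refl[OF \<beta>\<Phi>] by metis
        then show False using yp neg[OF \<gamma>pos] by simp
      qed
      ultimately show "refl a x \<in> inversions \<beta> - {a, \<gamma>}"
        using yp by (auto simp: inversions_def)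
    qed
  qed
  then have "card (inversions \<beta> - {a, \<gamma>}) = card (inversions (refl a \<beta>))"
    by (rule bij_betw_same_card)
  moreover have "finite (inversions \<beta>)" unfolding inversions_def by (rule fin_inversions[OF \<beta>\<Phi>])
  ultimately show ?thesis using card_Diff_subset[of "{a, \<gamma>}" "inversions \<beta>"] mem \<gamma>a
      card_mono[of "inversions \<beta>" "{a, \<gamma>}"] by auto
qed

text \<open>\<open>a\<close> is the only positive root whose sign \<open>refl a\<close> changes. It
  accounts for the 1 in \<open>2 * dp \<beta> + 1\<close>.\<close>

lemma inversions_simple: "a \<in> \<Delta> \<Longrightarrow> inversions a = {a}"
  unfolding inversions_def
  using refl_simple_positive simple_positive[of a] refl_self[of a] not_positive_iff[of "- a"] root_minus
  by auto

text \<open>Otherwise expanding \<open>B \<beta> \<beta>\<close> in simple roots gives a sum of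
  nonpositive terms, against \<open>B_pos\<close>.\<close>

lemma exists_descent:
  assumes "\<beta> \<in> pos"
  obtains a where "a \<in> \<Delta>" "0 < B \<beta> a"
proof (rule ccontr)
  note goal = that
  assume not: "\<not> thesis"
  have le: "B \<beta> a \<le> 0" if "a \<in> \<Delta>" for a using goal[OF that] not by linarith
  have Bsum: "B \<beta> (\<Sum>b\<in>A. c b *\<^sub>R b) = (\<Sum>b\<in>A. c b * B \<beta> b)" if "finite A" for A c
    using that by induction (use B_scale_right[of \<beta> 0 0] in \<open>auto simp: B_bilinear\<close>)
  have "B \<beta> \<beta> = (\<Sum>b\<in>\<Delta>. coeff \<beta> b * B \<beta> b)"
    using Bsum[OF fin_simple, of "coeff \<beta>"] root_eq_sum[of \<beta>] assms by simp
  also have "\<dots> \<le> 0"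
    using assms positive_coeff le by (intro sum_nonpos mult_nonneg_nonpos) auto
  finally show False using B_pos[of \<beta>] assms by auto
qed

section \<open>Depth as an inversion count\<close>

lemma refl_involution: "s \<in> refl ` \<Delta> \<Longrightarrow> s \<circ> s = id"
  using refl_refl simple_roots by (auto simp: fun_eq_iff)

text \<open>An ascent of \<open>\<beta>\<close> is a descent of \<open>refl a \<beta>\<close>, so
  \<open>card_inversions_refl\<close> settles both signs; if \<open>B \<beta> a\<close> vanishes,
  the root is fixed.\<close>

lemma card_inversions_refl_le:
  assumes "\<beta> \<in> pos" "a \<in> \<Delta>" "\<beta> \<noteq> a"
  shows "card (inversions \<beta>) \<le> card (inversions (refl a \<beta>)) + 2"
proof -
  have a\<Phi>: "a \<in> \<Phi>" using assms simple_roots by auto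
  consider "0 < B \<beta> a" | "B \<beta> a = 0" | "B \<beta> a < 0" by linarith
  then show ?thesis
  proof cases
    case 1
    then show ?thesis using card_inversions_refl[OF assms] by simp
  next
    case 2
    then show ?thesis by (simp add: refl_form_def)
  next
    case 3
    have p: "refl a \<beta> \<in> pos" using refl_simple_positive[OF assms] .
    have "refl a \<beta> \<noteq> a"
      using assms(1) refl_refl[OF a\<Phi>, of \<beta>] refl_self[OF a\<Phi>] simple_positive[OF assms(2)]
        not_positive_iff[OF a\<Phi>] by auto
    then show ?thesis
      using card_inversions_refl[OF p assms(2)] B_refl_simple[OF a\<Phi>] refl_refl[OF a\<Phi>] 3 by simp
  qed
qed

text \<open>Lower bound for the depth: each letter removes at most two inversions, and one is left
  at a simple root. The reversal puts the letter that acts first at the head of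
  \<open>ss\<close>.\<close>

lemma card_inversions_word:
  assumes "\<beta> \<in> pos" "set ss \<subseteq> refl ` \<Delta>" "word (rev ss) \<beta> \<in> \<Delta>"
  shows "card (inversions \<beta>) \<le> 2 * length ss + 1"
  using assms
proof (induction ss arbitrary: \<beta>)
  case Nil
  then show ?case by (simp add: inversions_simple)
next
  case (Cons s ss)
  then obtain a where a: "a \<in> \<Delta>" "s = refl a" by auto
  show ?case
  proof (cases "\<beta> = a")
    \<comment> \<open>The next root \<open>- a\<close> is negative and outside the induction
      hypothesis, but the count is already 1.\<close>
    case True
    then show ?thesis using a by (simp add: inversions_simple)
  next
    case False
    have "word (rev (s # ss)) \<beta> = word (rev ss) (refl a \<beta>)"
      by (simp add: word_append a(2))
    then have "word (rev ss) (refl a \<beta>) \<in> \<Delta>" using Cons.prems(3) by simp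
    then have "card (inversions (refl a \<beta>)) \<le> 2 * length ss + 1"
      using Cons.IH[of "refl a \<beta>"] Cons.prems refl_simple_positive[OF Cons.prems(1) a(1) False] by auto
    then show ?thesis using card_inversions_refl_le[OF Cons.prems(1) a(1) False] by simp
  qed
qed

text \<open>Greedy descent: while the root is not simple, the simple root from
  \<open>exists_descent\<close> differs from it, so the step stays positive and removes exactly two
  inversions.\<close>

lemma word_to_simple:
  assumes "\<beta> \<in> pos"
  shows "\<exists>ss. set ss \<subseteq> refl ` \<Delta> \<and> word ss \<beta> \<in> \<Delta> \<and> card (inversions \<beta>) = 2 * length ss + 1"
  using assms
proof (induction "card (inversions \<beta>)" arbitrary: \<beta> rule: less_induct)
  case less
  show ?case
  proof (cases "\<beta> \<in> \<Delta>")
    case True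
    then show ?thesis by (intro exI[of _ "[]"]) (simp add: inversions_simple)
  next
    case False
    obtain a where a: "a \<in> \<Delta>" "0 < B \<beta> a" using exists_descent[OF less.prems] .
    then have ne: "\<beta> \<noteq> a" using False by auto
    note c = card_inversions_refl[OF less.prems a(1) ne a(2)]
    obtain ss where "set ss \<subseteq> refl ` \<Delta>" "word ss (refl a \<beta>) \<in> \<Delta>"
      "card (inversions (refl a \<beta>)) = 2 * length ss + 1"
      using less.hyps[OF _ refl_simple_positive[OF less.prems a(1) ne]] c by auto
    then show ?thesis using c a
      by (intro exI[of _ "ss @ [refl a]"]) (auto simp: word_append)
  qed
qed

text \<open>\<open>word_to_simple\<close> bounds the depth from above and
  \<open>card_inversions_word\<close> bounds it from below.\<close>

lemma card_inversions_eq_dp: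
  assumes "\<beta> \<in> pos"
  shows "card (inversions \<beta>) = 2 * dp \<beta> + 1"
proof -
  let ?P = "\<lambda>n. \<exists>w\<in>gen_group (refl ` \<Delta>). w \<beta> \<in> \<Delta> \<and> word_length (refl ` \<Delta>) w = n"
  obtain ss where ss: "set ss \<subseteq> refl ` \<Delta>" "word ss \<beta> \<in> \<Delta>"
    "card (inversions \<beta>) = 2 * length ss + 1"
    using word_to_simple[OF assms] by blast
  then have P: "?P (word_length (refl ` \<Delta>) (word ss))"
    using word_in_gen_group by blast
  have "dp \<beta> \<le> word_length (refl ` \<Delta>) (word ss)"
    unfolding dp_def by (rule Least_le[of ?P, OF P])
  also have "\<dots> \<le> length ss" by (rule word_length_le[OF ss(1)])
  finally have le: "dp \<beta> \<le> length ss" .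
  have "?P (dp \<beta>)" unfolding dp_def by (rule LeastI[of ?P, OF P])
  then obtain w where w: "w \<in> gen_group (refl ` \<Delta>)" "w \<beta> \<in> \<Delta>" "word_length (refl ` \<Delta>) w = dp \<beta>"
    by blast
  obtain ts where ts: "set ts \<subseteq> refl ` \<Delta>" "length ts = dp \<beta>" "word ts = w"
    using word_length_witness[OF refl_involution w(1)] w(3) by metis
  have "card (inversions \<beta>) \<le> 2 * dp \<beta> + 1"
    using card_inversions_word[of \<beta> "rev ts"] ts w assms by simp
  then show ?thesis using le ss by simp
qed

lemma dp_simple: "a \<in> \<Delta> \<Longrightarrow> dp a = 0"
  using card_inversions_eq_dp[OF simple_positive] inversions_simple by simp

text \<open>Half the change in the number of inversions; for an ascent the descent formula is
  applied to \<open>refl a \<beta>\<close>.\<close>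

lemma dp_refl:
  assumes "\<beta> \<in> pos" "a \<in> \<Delta>" "\<beta> \<noteq> a"
  shows "int (dp (refl a \<beta>)) = int (dp \<beta>) - sgn (B \<beta> a)"
proof -
  have a\<Phi>: "a \<in> \<Phi>" using assms simple_roots by auto
  have p: "refl a \<beta> \<in> pos" using refl_simple_positive[OF assms] .
  have down: "dp x = dp (refl a x) + 1" if "x \<in> pos" "x \<noteq> a" "0 < B x a" for x
    using card_inversions_refl[OF that(1) assms(2) that(2,3)] card_inversions_eq_dp[OF that(1)]
      card_inversions_eq_dp[OF refl_simple_positive[OF that(1) assms(2) that(2)]] by simp
  have "refl a \<beta> \<noteq> a"
    using assms(1) refl_refl[OF a\<Phi>, of \<beta>] refl_self[OF a\<Phi>] simple_positive[OF assms(2)]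
      not_positive_iff[OF a\<Phi>] by auto
  then show ?thesis
    using down[OF assms(1,3)] down[OF p] B_refl_simple[OF a\<Phi>, of \<beta>] refl_refl[OF a\<Phi>, of \<beta>]
    by (cases "B \<beta> a" "0::real" rule: linorder_cases) (auto simp: refl_form_def)
qed

section \<open>Signed depth and ascending chains\<close>

lemma signed_depth_minus: "\<beta> \<in> \<Phi> \<Longrightarrow> signed_depth (- \<beta>) = - 1 - signed_depth \<beta>"
  using not_positive_iff[of \<beta>] by (auto simp: signed_depth_def)

text \<open>At \<open>a\<close> itself the value drops from 0 to -1, as the sign of
  \<open>B a a\<close> demands. Negative roots follow by negation, which reverses both the scale and
  the sign.\<close>

lemma signed_depth_refl:
  assumes "\<beta> \<in> \<Phi>" "a \<in> \<Delta>"
  shows "real_of_int (signed_depth (refl a \<beta>)) = signed_depth \<beta> - sgn (B \<beta> a)"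
proof -
  have a\<Phi>: "a \<in> \<Phi>" using assms simple_roots by auto
  have pos_case: "real_of_int (signed_depth (refl a x)) = signed_depth x - sgn (B x a)" if "x \<in> pos" for x
  proof (cases "x = a")
    case True
    then show ?thesis
      using assms a\<Phi> B_pos[OF a\<Phi>] simple_positive[of a] signed_depth_minus[OF a\<Phi>]
      by (simp add: refl_self signed_depth_def dp_simple)
  next
    case False
    then show ?thesis
      using dp_refl[OF that assms(2) False] refl_simple_positive[OF that assms(2) False] that
      by (simp add: signed_depth_def)
  qed
  show ?thesis
  proof (cases "\<beta> \<in> nonneg_comb \<Delta>")
    case True
    then show ?thesis using pos_case assms by blast
  next
    case False
    then have "- \<beta> \<in> pos" using assms not_positive_iff root_minus by blast
    from pos_case[OF this] show ?thesis
      using signed_depth_minus[OF assms(1)] signed_depth_minus[OF refl_root[OF a\<Phi> assms(1)]]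
      by (simp add: refl_minus B_minus sgn_minus)
  qed
qed

lemma up_root: "up x y \<Longrightarrow> x \<in> \<Phi> \<Longrightarrow> y \<in> \<Phi>"
  using refl_root simple_roots by (auto simp: up_def)

lemma up_positive: "up x y \<Longrightarrow> x \<in> pos \<Longrightarrow> y \<in> pos"
proof -
  assume "up x y" and x: "x \<in> pos"
  then obtain a where a: "a \<in> \<Delta>" "B x a < 0" "y = refl a x" by (auto simp: up_def)
  then have "x \<noteq> a" using B_pos[of a] simple_roots by force
  then show ?thesis using refl_simple_positive x a by blast
qed

lemma up_chain_positive: "up\<^sup>*\<^sup>* x y \<Longrightarrow> x \<in> pos \<Longrightarrow> y \<in> pos"
  by (induction rule: rtranclp_induct) (use up_positive in blast)+

lemma up_signed_depth: "up x y \<Longrightarrow> x \<in> \<Phi> \<Longrightarrow> signed_depth y = signed_depth x + 1"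
  using signed_depth_refl[of x] by (fastforce simp: up_def)

lemma up_chain_signed_depth:
  assumes "up\<^sup>*\<^sup>* x y" "x \<in> \<Phi>"
  shows "signed_depth x < signed_depth y \<or> x = y"
proof -
  have "y \<in> \<Phi> \<and> (signed_depth x < signed_depth y \<or> x = y)"
    using assms
  proof (induction rule: rtranclp_induct)
    case (step y z)
    then show ?case using up_root[of y z] up_signed_depth[of y z] by auto
  qed simp
  then show ?thesis by blast
qed

text \<open>One letter raises the signed depth by at most one, and by one only in an
  \<open>up\<close> step. A word attaining the total bound must attain it at every letter.\<close>

lemma word_signed_depth:
  assumes "set ss \<subseteq> refl ` \<Delta>" "x \<in> \<Phi>"
  shows "word ss x \<in> \<Phi> \<and> signed_depth (word ss x) \<le> signed_depth x + int (length ss)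
    \<and> (signed_depth (word ss x) = signed_depth x + int (length ss) \<longrightarrow> up\<^sup>*\<^sup>* x (word ss x))"
  using assms(1)
proof (induction ss)
  case Nil
  then show ?case using assms(2) by simp
next
  case (Cons s ss)
  then obtain a where a: "a \<in> \<Delta>" "s = refl a" by auto
  define y where "y = word ss x"
  have IH: "y \<in> \<Phi>" "signed_depth y \<le> signed_depth x + int (length ss)"
    "signed_depth y = signed_depth x + int (length ss) \<Longrightarrow> up\<^sup>*\<^sup>* x y"
    using Cons by (auto simp: y_def)
  have z: "refl a y \<in> \<Phi>" using refl_root IH(1) a simple_roots by blast
  note sd = signed_depth_refl[OF IH(1) a(1)]
  consider "B y a < 0" | "B y a \<ge> 0" by linarith
  then have "signed_depth (refl a y) = signed_depth y + 1 \<and> up y (refl a y)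
      \<or> signed_depth (refl a y) \<le> signed_depth y"
  proof cases
    case 1
    then show ?thesis using up_signed_depth[of y "refl a y"] IH(1) a by (auto simp: up_def)
  next
    case 2
    then have "real_of_int (signed_depth (refl a y)) \<le> signed_depth y"
      using sd by (auto simp: sgn_if split: if_splits)
    then show ?thesis by simp
  qed
  then have "signed_depth (refl a y) \<le> signed_depth x + int (length (s # ss))
    \<and> (signed_depth (refl a y) = signed_depth x + int (length (s # ss)) \<longrightarrow> up\<^sup>*\<^sup>* x (refl a y))"
    using IH(2,3) by (auto intro: rtranclp.rtrancl_into_rtrancl)
  then show ?case using z a by (simp add: y_def)
qed

lemma up_chain_word:
  assumes "up\<^sup>*\<^sup>* x y" "x \<in> \<Phi>"
  shows "\<exists>ss. set ss \<subseteq> refl ` \<Delta> \<and> word ss x = y \<and> y \<in> \<Phi> \<and>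
    int (length ss) = signed_depth y - signed_depth x"
  using assms
proof (induction rule: rtranclp_induct)
  case base
  then show ?case by (intro exI[of _ "[]"]) simp
next
  case (step y z)
  then obtain ss where ss: "set ss \<subseteq> refl ` \<Delta>" "word ss x = y" "y \<in> \<Phi>"
    "int (length ss) = signed_depth y - signed_depth x" by blast
  obtain a where a: "a \<in> \<Delta>" "z = refl a y" using step(2) by (auto simp: up_def)
  show ?case
    using ss a up_signed_depth[OF step(2)] up_root[OF step(2)]
    by (intro exI[of _ "refl a # ss"]) auto
qed

text \<open>The length condition says that a shortest word for \<open>w\<close> attains the bound of
  \<open>word_signed_depth\<close>, which forces a chain of \<open>up\<close> steps.\<close>

lemma root_order_iff_up_chain:
  assumes x: "x \<in> pos" and y: "y \<in> pos"
  shows "(\<exists>w\<in>gen_group (refl ` \<Delta>). w x = y \<and>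
      int (word_length (refl ` \<Delta>) w) = int (dp y) - int (dp x)) \<longleftrightarrow> up\<^sup>*\<^sup>* x y"
proof -
  have sd: "int (dp y) - int (dp x) = signed_depth y - signed_depth x"
    using x y by (simp add: signed_depth_def)
  show ?thesis
  proof
    assume "\<exists>w\<in>gen_group (refl ` \<Delta>). w x = y \<and>
      int (word_length (refl ` \<Delta>) w) = int (dp y) - int (dp x)"
    then obtain w where w: "w \<in> gen_group (refl ` \<Delta>)" "w x = y"
      "int (word_length (refl ` \<Delta>) w) = signed_depth y - signed_depth x" using sd by metis
    obtain ss where "set ss \<subseteq> refl ` \<Delta>" "length ss = word_length (refl ` \<Delta>) w" "word ss = w"
      using word_length_witness[OF refl_involution w(1)] by metis
    then show "up\<^sup>*\<^sup>* x y" using word_signed_depth[of ss x] w x by simp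
  next
    assume "up\<^sup>*\<^sup>* x y"
    then obtain ss where ss: "set ss \<subseteq> refl ` \<Delta>" "word ss x = y"
      "int (length ss) = signed_depth y - signed_depth x" using up_chain_word x by blast
    define w where "w = word ss"
    have w: "w \<in> gen_group (refl ` \<Delta>)" using word_in_gen_group[OF ss(1)] by (simp add: w_def)
    \<comment> \<open>The word read off the chain might not be shortest for \<open>w\<close>, but a
      shortest one still needs a letter for each unit of depth.\<close>
    obtain ts where ts: "set ts \<subseteq> refl ` \<Delta>" "length ts = word_length (refl ` \<Delta>) w" "word ts = w"
      using word_length_witness[OF refl_involution w] by metis
    have "word_length (refl ` \<Delta>) w \<le> length ss" using word_length_le[OF ss(1)] by (simp add: w_def)
    moreover have "signed_depth y \<le> signed_depth x + int (length ts)"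
      using word_signed_depth[OF ts(1), of x] x ts(3) ss(2) by (auto simp: w_def)
    ultimately have "int (word_length (refl ` \<Delta>) w) = int (dp y) - int (dp x)"
      using ss(3) ts(2) sd by simp
    then show "\<exists>w\<in>gen_group (refl ` \<Delta>). w x = y \<and>
      int (word_length (refl ` \<Delta>) w) = int (dp y) - int (dp x)" using w ss(2) w_def by blast
  qed
qed

text \<open>Signed depth is integral and strictly increasing along chains, and the ends differ by
  one.\<close>

lemma up_no_between:
  assumes "up x y" "x \<in> \<Phi>" "up\<^sup>*\<^sup>* x z" "up\<^sup>*\<^sup>* z y"
  shows "z = x \<or> z = y"
proof -
  have "z \<in> \<Phi>" using assms(3,2) by (induction rule: rtranclp_induct) (auto dest: up_root)
  then show ?thesis
    using up_signed_depth[OF assms(1,2)] up_chain_signed_depth[OF assms(3,2)]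
      up_chain_signed_depth[OF assms(4)] by auto
qed

end

section \<open>The affine root system\<close>

lemma refl_aff_form:
  "refl_form aff_form (c, k) (d, j) =
    (refl_form (\<bullet>) c d, j - 2 * (d \<bullet> c / (c \<bullet> c)) * k)"
  by (simp add: refl_form_def aff_form_def)

lemma Ints_less_imp_le:
  fixes x y :: real
  assumes "x \<in> \<int>" "y \<in> \<int>" "x < y"
  shows "x + 1 \<le> y"
  using assms by (auto elim!: Ints_cases)

locale affine_setting =
  fixes \<Phi>0 \<Delta>0 :: "'a::euclidean_space set" and \<omega> :: 'a
  assumes cryst: "crystallographic_root_system \<Phi>0"
    and red: "reduced_root_system \<Phi>0"
    and simple: "simple_system \<Phi>0 \<Delta>0"
    and high: "highest_root \<Phi>0 \<Delta>0 \<omega>"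
begin

abbreviation affine_roots :: "('a \<times> real) set" where "affine_roots \<equiv> \<Phi>0 \<times> \<int>"

section \<open>Finite roots and the cone of the affine simple roots\<close>

lemma fin_roots: "finite \<Phi>0" and zero_not_root: "0 \<notin> \<Phi>0"
  using cryst by (auto simp: crystallographic_root_system_def)

lemma root_refl: "c \<in> \<Phi>0 \<Longrightarrow> d \<in> \<Phi>0 \<Longrightarrow> refl_form (\<bullet>) c d \<in> \<Phi>0"
  using cryst unfolding crystallographic_root_system_def by blast

lemma cartan_int: "c \<in> \<Phi>0 \<Longrightarrow> d \<in> \<Phi>0 \<Longrightarrow> 2 * (d \<bullet> c / (c \<bullet> c)) \<in> \<int>"
  using cryst unfolding crystallographic_root_system_def by auto

lemma root_uminus: "c \<in> \<Phi>0 \<Longrightarrow> - c \<in> \<Phi>0"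
proof -
  assume c: "c \<in> \<Phi>0"
  then have "c \<noteq> 0" using zero_not_root by auto
  then show ?thesis using root_refl[OF c c] by (simp add: refl_form_def scaleR_2)
qed

lemma simple_root: "\<Delta>0 \<subseteq> \<Phi>0" and simple_indep: "independent \<Delta>0"
  and simple_sign: "c \<in> \<Phi>0 \<Longrightarrow> c \<in> nonneg_comb \<Delta>0 \<or> - c \<in> nonneg_comb \<Delta>0"
  using simple by (auto simp: simple_system_def)

lemma fin_simple_roots: "finite \<Delta>0"
  using fin_roots simple_root by (rule finite_subset[rotated])

lemma highest: "\<omega> \<in> \<Phi>0" "c \<in> \<Phi>0 \<Longrightarrow> \<omega> - c \<in> nonneg_comb \<Delta>0"
  using high by (auto simp: highest_root_def)

lemma highest_add: "c \<in> \<Phi>0 \<Longrightarrow> \<omega> + c \<in> nonneg_comb \<Delta>0"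
  using highest(2)[of "- c"] root_uminus by simp

text \<open>\<omega> - (- \<omega>) lies in the cone; halve it.\<close>

lemma highest_positive: "\<omega> \<in> nonneg_comb \<Delta>0"
proof -
  have "(1/2) *\<^sub>R (\<omega> + \<omega>) \<in> nonneg_comb \<Delta>0"
    using highest_add[OF highest(1)] by (rule nonneg_comb_scale) simp
  then show ?thesis by (simp add: scaleR_2[symmetric])
qed

lemma linear_fin_emb: "linear fin_emb"
  by (rule linearI) (auto simp: fin_emb_def)

lemma inj_fin_emb: "inj fin_emb"
  by (rule injI) (simp add: fin_emb_def)

lemma delta_minus_eq: "delta - fin_emb \<omega> = (- \<omega>, 1)"
  by (simp add: delta_def fin_emb_def)

lemma aff_simple_eq: "aff_simple \<Delta>0 \<omega> = insert (- \<omega>, 1) (fin_emb ` \<Delta>0)"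
  by (simp add: aff_simple_def delta_minus_eq)

text \<open>The coefficient of \<delta> - \<omega> must be the level \<open>k\<close>; removing that
  multiple leaves the finite vector \<open>v + k *\<^sub>R \<omega>\<close>.\<close>

lemma aff_cone_iff:
  "(v, k) \<in> nonneg_comb (aff_simple \<Delta>0 \<omega>) \<longleftrightarrow> 0 \<le> k \<and> v + k *\<^sub>R \<omega> \<in> nonneg_comb \<Delta>0"
proof -
  have "(- \<omega>, 1) \<notin> fin_emb ` \<Delta>0" by (auto simp: fin_emb_def)
  then have "(v, k) \<in> nonneg_comb (aff_simple \<Delta>0 \<omega>) \<longleftrightarrow>
      (\<exists>t\<ge>0. (v, k) - t *\<^sub>R (- \<omega>, 1) \<in> fin_emb ` nonneg_comb \<Delta>0)"
    unfolding aff_simple_eq nonneg_comb_linear_image[OF linear_fin_emb inj_fin_emb, symmetric]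
    using fin_simple_roots by (intro nonneg_comb_insert) auto
  also have "\<dots> \<longleftrightarrow> 0 \<le> k \<and> v + k *\<^sub>R \<omega> \<in> nonneg_comb \<Delta>0"
    by (auto simp: fin_emb_def image_iff)
  finally show ?thesis .
qed

text \<open>Write c + k\<omega> as (\<omega> + c) + (k - 1)\<omega>; both summands lie in the finite
  cone because \<omega> is highest.\<close>

lemma aff_cone_level_ge_1:
  assumes "c \<in> \<Phi>0" "1 \<le> k"
  shows "(c, k) \<in> nonneg_comb (aff_simple \<Delta>0 \<omega>)"
proof -
  have "(\<omega> + c) + (k - 1) *\<^sub>R \<omega> \<in> nonneg_comb \<Delta>0"
    using assms by (intro nonneg_comb_add highest_add nonneg_comb_scale highest_positive) auto
  then show ?thesis using assms(2) by (simp add: aff_cone_iff algebra_simps)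
qed

lemma aff_root_sign:
  assumes "\<beta> \<in> affine_roots"
  shows "\<beta> \<in> nonneg_comb (aff_simple \<Delta>0 \<omega>) \<or> - \<beta> \<in> nonneg_comb (aff_simple \<Delta>0 \<omega>)"
proof -
  obtain c k where ck: "\<beta> = (c, k)" "c \<in> \<Phi>0" "k \<in> \<int>" using assms by auto
  consider "k = 0" | "1 \<le> k" | "1 \<le> - k"
    using Ints_less_imp_le[of 0 k] Ints_less_imp_le[of k 0] ck(3) by fastforce
  then show ?thesis
  proof cases
    case 1
    then show ?thesis using simple_sign[OF ck(2)] ck by (simp add: aff_cone_iff)
  next
    case 2
    then show ?thesis using aff_cone_level_ge_1 ck by simp
  next
    case 3
    then show ?thesis using aff_cone_level_ge_1[OF root_uminus] ck by simp
  qed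
qed

text \<open>Finite simple roots have level 0 while \<delta> - \<omega> has level 1.\<close>

lemma aff_simple_indep: "independent (aff_simple \<Delta>0 \<omega>)"
proof -
  have "independent (fin_emb ` \<Delta>0)"
    using simple_indep inj_fin_emb
    by (intro linear_independent_injective_image linear_fin_emb) (auto intro: inj_on_subset)
  moreover have "(- \<omega>, 1) \<notin> span (fin_emb ` \<Delta>0)"
    unfolding linear_span_image[OF linear_fin_emb] by (auto simp: fin_emb_def)
  ultimately show ?thesis by (simp add: aff_simple_eq independent_insertI)
qed

lemma aff_simple_roots: "aff_simple \<Delta>0 \<omega> \<subseteq> affine_roots"
  using simple_root highest(1) root_uminus by (auto simp: aff_simple_eq fin_emb_def)

lemma aff_refl_root:
  "\<beta> \<in> affine_roots \<Longrightarrow> \<gamma> \<in> affine_roots \<Longrightarrow> refl_form aff_form \<beta> \<gamma> \<in> affine_roots"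
proof (cases \<beta>, cases \<gamma>)
  fix c k d j assume "\<beta> \<in> affine_roots" "\<gamma> \<in> affine_roots" "\<beta> = (c, k)" "\<gamma> = (d, j)"
  then show ?thesis
    using root_refl[of c d] Ints_mult[OF cartan_int[of c d], of k] Ints_diff[of j]
    by (simp add: refl_aff_form)
qed

text \<open>An inversion has nonnegative level, and its image has level below 1 because roots of
  level at least 1 are positive. Each of the finitely many finite parts thus leaves a bounded range
  of integers.\<close>

lemma finite_aff_inversions:
  assumes "\<beta> \<in> affine_roots"
  shows "finite {\<gamma> \<in> affine_roots \<inter> nonneg_comb (aff_simple \<Delta>0 \<omega>).
    refl_form aff_form \<beta> \<gamma> \<notin> nonneg_comb (aff_simple \<Delta>0 \<omega>)}" (is "finite ?I")
proof -
  obtain c k where ck: "\<beta> = (c, k)" "c \<in> \<Phi>0" "k \<in> \<int>" using assms by auto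
  let ?m = "\<lambda>d. 1 + 2 * (d \<bullet> c / (c \<bullet> c)) * k"
  have "?I \<subseteq> (SIGMA d:\<Phi>0. {x \<in> \<int>. 0 \<le> x \<and> x \<le> ?m d})"
  proof
    fix \<gamma> assume g: "\<gamma> \<in> ?I"
    then obtain d j where dj: "\<gamma> = (d, j)" "d \<in> \<Phi>0" "j \<in> \<int>" by auto
    have "0 \<le> j" using g dj by (simp add: aff_cone_iff)
    moreover have "\<not> 1 \<le> j - 2 * (d \<bullet> c / (c \<bullet> c)) * k"
      using g aff_cone_level_ge_1[OF root_refl[OF ck(2) dj(2)]] unfolding ck(1) dj(1) by (auto simp: refl_aff_form)
    ultimately show "\<gamma> \<in> (SIGMA d:\<Phi>0. {x \<in> \<int>. 0 \<le> x \<and> x \<le> ?m d})"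
      using dj by simp
  qed
  moreover have "finite (SIGMA d:\<Phi>0. {x \<in> \<int>. 0 \<le> x \<and> x \<le> ?m d})"
    by (intro finite_SigmaI fin_roots finite_int_segment)
  ultimately show ?thesis by (rule finite_subset)
qed

lemma aff_root_reduced:
  assumes "\<beta> \<in> affine_roots" "t *\<^sub>R \<beta> \<in> affine_roots"
  shows "t = 1 \<or> t = -1"
proof -
  have "fst \<beta> \<in> \<Phi>0" "t *\<^sub>R fst \<beta> \<in> \<Phi>0" using assms by auto
  then show ?thesis using red unfolding reduced_root_system_def by blast
qed

section \<open>The affine roots as a based root system\<close>

sublocale root_basis aff_form affine_roots "aff_simple \<Delta>0 \<omega>"
proof
  show "aff_form x y = aff_form y x" "aff_form (x + y) z = aff_form x z + aff_form y z"
    "aff_form (t *\<^sub>R x) z = t * aff_form x z" for x y z :: "'a \<times> real" and t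
    by (auto simp: aff_form_def inner_commute inner_add_right)
  show "0 < aff_form \<beta> \<beta>" if "\<beta> \<in> affine_roots" for \<beta>
    using that zero_not_root by (auto simp: aff_form_def)
  show "finite (aff_simple \<Delta>0 \<omega>)" using fin_simple_roots by (simp add: aff_simple_eq)
qed (fact aff_simple_indep aff_simple_roots aff_refl_root aff_root_sign aff_root_reduced
    finite_aff_inversions)+

lemma aff_pos_roots_eq: "aff_pos_roots \<Phi>0 \<Delta>0 = pos"
proof (intro equalityI subsetI)
  fix x assume "x \<in> aff_pos_roots \<Phi>0 \<Delta>0"
  then consider k \<alpha> where "x = real k *\<^sub>R delta + fin_emb \<alpha>" "\<alpha> \<in> fin_pos_roots \<Phi>0 \<Delta>0"
    | k \<alpha> where "x = real (k + 1) *\<^sub>R delta - fin_emb \<alpha>" "\<alpha> \<in> fin_pos_roots \<Phi>0 \<Delta>0"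
    unfolding aff_pos_roots_def by blast
  then show "x \<in> pos"
  proof cases
    case 1
    then have x: "x = (\<alpha>, real k)" and \<alpha>: "\<alpha> \<in> \<Phi>0" "\<alpha> \<in> nonneg_comb \<Delta>0"
      by (auto simp: delta_def fin_emb_def fin_pos_roots_def)
    have "\<alpha> + real k *\<^sub>R \<omega> \<in> nonneg_comb \<Delta>0"
      by (intro nonneg_comb_add \<alpha> nonneg_comb_scale highest_positive) simp
    then show ?thesis using \<alpha> x by (simp add: aff_cone_iff)
  next
    case 2
    then have x: "x = (- \<alpha>, real k + 1)" and \<alpha>: "\<alpha> \<in> \<Phi>0"
      by (auto simp: delta_def fin_emb_def fin_pos_roots_def)
    have "real k + 1 \<in> \<int>" by simp
    then show ?thesis using aff_cone_level_ge_1[OF root_uminus[OF \<alpha>], of "real k + 1"] x root_uminus[OF \<alpha>] by simp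
  qed
next
  fix x assume x: "x \<in> pos"
  then obtain c k where ck: "x = (c, k)" "c \<in> \<Phi>0" "k \<in> \<int>" "0 \<le> k" by (auto simp: aff_cone_iff)
  then obtain n where n: "k = real n" by (metis Ints_cases of_int_0_le_iff of_int_of_nat_eq nonneg_int_cases)
  show "x \<in> aff_pos_roots \<Phi>0 \<Delta>0"
  proof (cases "c \<in> nonneg_comb \<Delta>0")
    case True
    then have "x = real n *\<^sub>R delta + fin_emb c" "c \<in> fin_pos_roots \<Phi>0 \<Delta>0"
      using ck n by (auto simp: delta_def fin_emb_def fin_pos_roots_def)
    then show ?thesis unfolding aff_pos_roots_def by blast
  next
    case False
    \<comment> \<open>At level 0 positivity would put \<open>c\<close> in the finite cone. The level
      is therefore a successor, as the second family of positive roots requires.\<close>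
    have "n \<noteq> 0"
    proof
      assume "n = 0"
      then show False using False x ck n by (simp add: aff_cone_iff)
    qed
    then obtain m where m: "n = m + 1" by (metis Suc_eq_plus1 not0_implies_Suc)
    have "- c \<in> fin_pos_roots \<Phi>0 \<Delta>0"
      using False simple_sign[OF ck(2)] root_uminus[OF ck(2)] by (auto simp: fin_pos_roots_def)
    moreover have "x = real (m + 1) *\<^sub>R delta - fin_emb (- c)"
      using ck n m by (auto simp: delta_def fin_emb_def)
    ultimately show ?thesis unfolding aff_pos_roots_def by blast
  qed
qed

lemma root_le_iff:
  assumes "x \<in> pos" "y \<in> pos"
  shows "root_le \<Phi>0 \<Delta>0 \<omega> x y \<longleftrightarrow> up\<^sup>*\<^sup>* x y"
proof -
  have "depth \<Delta>0 \<omega> = dp"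
    by (simp add: fun_eq_iff depth_def dp_def aff_weyl_group_def aff_length_def aff_refls_def)
  then show ?thesis
    unfolding root_order_iff_up_chain[OF assms, symmetric] root_le_def aff_pos_roots_eq
    using assms by (simp add: aff_weyl_group_def aff_length_def aff_refls_def)
qed

section \<open>Chains of constant level\<close>

definition fin_up :: "'a \<Rightarrow> 'a \<Rightarrow> bool" where
  "fin_up c d \<longleftrightarrow> (\<exists>a\<in>\<Delta>0. c \<bullet> a < 0 \<and> d = refl_form (\<bullet>) a c)"

text \<open>For the affine simple root the sign condition means
  \<open>0 < c \<bullet> \<omega>\<close>, and the reflection adds a positive multiple of this to
  the level.\<close>

lemma up_level:
  assumes "up x y"
  shows "snd x < snd y \<or> snd x = snd y \<and> fin_up (fst x) (fst y)"
proof -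
  obtain a where a: "a \<in> aff_simple \<Delta>0 \<omega>" "aff_form x a < 0" "y = refl_form aff_form a x"
    using assms by (auto simp: up_def)
  obtain c k where x: "x = (c, k)" by (cases x)
  consider "a = (- \<omega>, 1)" | b where "b \<in> \<Delta>0" "a = (b, 0)"
    using a(1) by (auto simp: aff_simple_eq fin_emb_def)
  then show ?thesis
  proof cases
    case 1
    then have "0 < c \<bullet> \<omega>" using a(2) x by (simp add: aff_form_def)
    moreover have "0 < \<omega> \<bullet> \<omega>" using highest(1) zero_not_root by auto
    ultimately show ?thesis using a(3) 1 x by (simp add: refl_aff_form)
  next
    case 2
    then show ?thesis using a x by (auto simp: refl_aff_form aff_form_def fin_up_def)
  qed
qed

lemma fin_up_imp_up: "fin_up c d \<Longrightarrow> up (c, k) (d, k)"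
  unfolding fin_up_def up_def
  by (force simp: aff_simple_eq fin_emb_def refl_aff_form aff_form_def)

lemma up_chain_level:
  assumes "up\<^sup>*\<^sup>* x y"
  shows "snd x < snd y \<or> snd x = snd y \<and> fin_up\<^sup>*\<^sup>* (fst x) (fst y)"
  using assms
proof (induction rule: rtranclp_induct)
  case (step y z)
  then show ?case using up_level[OF step(2)] by (auto intro: rtranclp.rtrancl_into_rtrancl)
qed simp

text \<open>Equal end levels exclude affine steps. The right side does not involve \<open>k\<close>,
  so levels 0 and 1 carry the same chains.\<close>

lemma up_chain_iff: "up\<^sup>*\<^sup>* (c, k) (d, k) \<longleftrightarrow> fin_up\<^sup>*\<^sup>* c d"
proof
  show "up\<^sup>*\<^sup>* (c, k) (d, k)" if "fin_up\<^sup>*\<^sup>* c d"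
    using that by induction (auto intro: rtranclp.rtrancl_into_rtrancl fin_up_imp_up)
qed (use up_chain_level in fastforce)

text \<open>The same \<open>a\<close> works: reflection and negation each change the sign of the
  product with \<open>a\<close>, and the reflection is an involution.\<close>

lemma fin_up_minus: "fin_up c d \<Longrightarrow> fin_up (- d) (- c)"
proof -
  assume "fin_up c d"
  then obtain a where a: "a \<in> \<Delta>0" "c \<bullet> a < 0" "d = refl_form (\<bullet>) a c" by (auto simp: fin_up_def)
  then have "a \<bullet> a \<noteq> 0" using zero_not_root simple_root by auto
  then have "- d \<bullet> a = c \<bullet> a" "- c = refl_form (\<bullet>) a (- d)"
    using a(3) by (auto simp: refl_form_def inner_diff_left)
  then show "fin_up (- d) (- c)" using a unfolding fin_up_def by metis
qed

lemma fin_up_chain_minus: "fin_up\<^sup>*\<^sup>* (- d) (- c) \<longleftrightarrow> fin_up\<^sup>*\<^sup>* c d"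
proof -
  have *: "fin_up\<^sup>*\<^sup>* (- d) (- c)" if "fin_up\<^sup>*\<^sup>* c d" for c d
    using that by induction (auto intro: converse_rtranclp_into_rtranclp fin_up_minus)
  show ?thesis using *[of c d] *[of "- d" "- c"] by auto
qed

lemma fin_up_chain_positive:
  assumes "fin_up\<^sup>*\<^sup>* c d" "c \<in> fin_pos_roots \<Phi>0 \<Delta>0"
  shows "d \<in> fin_pos_roots \<Phi>0 \<Delta>0"
  using up_chain_positive[of "(c, 0)" "(d, 0)"] assms
  by (simp add: up_chain_iff aff_cone_iff fin_pos_roots_def)

lemma fin_up_ne: "fin_up c d \<Longrightarrow> c \<noteq> d"
  using zero_not_root simple_root by (auto simp: fin_up_def refl_form_def)

text \<open>Together with \<open>fin_up_chain_positive\<close> this keeps every chain that starts in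
  \<open>\<O>\<^sup>+\<close> inside \<open>\<O>\<^sup>+\<close>.\<close>

lemma fin_up_orbit:
  assumes "fin_up\<^sup>*\<^sup>* c d" "c \<in> fin_weyl_orbit \<Delta>0 \<gamma>"
  shows "d \<in> fin_weyl_orbit \<Delta>0 \<gamma>"
  using assms
proof (induction rule: rtranclp_induct)
  case (step d e)
  then obtain w a where w: "w \<in> fin_weyl_group \<Delta>0" "d = w \<gamma>" and a: "a \<in> \<Delta>0" "e = refl_form (\<bullet>) a d"
    by (auto simp: fin_weyl_orbit_def fin_up_def)
  then have "refl_form (\<bullet>) a \<circ> w \<in> fin_weyl_group \<Delta>0" "e = (refl_form (\<bullet>) a \<circ> w) \<gamma>"
    unfolding fin_weyl_group_def by (auto intro: gen_group.intros)
  then show ?case unfolding fin_weyl_orbit_def by blast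
qed

section \<open>Covers and shortness\<close>

lemma up_covers:
  assumes "up x y" "x \<in> pos"
  shows "covers_in (root_le \<Phi>0 \<Delta>0 \<omega>) (aff_pos_roots \<Phi>0 \<Delta>0) x y"
proof -
  have y: "y \<in> pos" using up_positive assms by blast
  have "x \<noteq> y" using up_signed_depth[OF assms(1)] assms(2) by auto
  then show ?thesis
    unfolding covers_in_def aff_pos_roots_eq
    using assms y up_no_between[OF assms(1)] root_le_iff by auto
qed

lemma fin_pos_minus: "c \<in> fin_pos_roots \<Phi>0 \<Delta>0 \<Longrightarrow> - c \<notin> fin_pos_roots \<Phi>0 \<Delta>0"
  using not_positive_iff[of "(c, 0)"] by (auto simp: fin_pos_roots_def aff_cone_iff)

lemma simple_fin_pos: "a \<in> \<Delta>0 \<Longrightarrow> a \<in> fin_pos_roots \<Phi>0 \<Delta>0"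
proof -
  assume "a \<in> \<Delta>0"
  then have "(a, 0) \<in> pos" by (intro simple_positive) (simp add: aff_simple_eq fin_emb_def)
  then show ?thesis by (simp add: fin_pos_roots_def aff_cone_iff)
qed

text \<open>Equality in Cauchy-Schwarz would make \<open>c\<close> a multiple of \<open>a\<close>,
  hence \<open>a\<close> or \<open>- a\<close>. The sign of \<open>c \<bullet> a\<close> excludes
  the former; assumption \<open>y\<close> excludes \<open>c = - a\<close>, where
  \<open>d = a\<close>. Its first alternative serves \<open>\<O>\<^sup>+\<close>, its second
  \<open>\<delta> - \<O>\<^sup>+\<close>.\<close>

lemma short_coverI:
  assumes up: "fin_up c d" and x: "(c, k) \<in> pos"
    and y: "c \<in> fin_pos_roots \<Phi>0 \<Delta>0 \<or> - d \<in> fin_pos_roots \<Phi>0 \<Delta>0"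
  shows "short_cover \<Phi>0 \<Delta>0 \<omega> (c, k) (d, k)"
proof -
  obtain a where a: "a \<in> \<Delta>0" "c \<bullet> a < 0" "d = refl_form (\<bullet>) a c"
    using up by (auto simp: fin_up_def)
  have c: "c \<in> \<Phi>0" and a\<Phi>: "a \<in> \<Phi>0" using x a simple_root by auto
  have a0: "a \<noteq> 0" using a\<Phi> zero_not_root by auto
  have "c \<noteq> - a"
  proof
    assume "c = - a"
    moreover from this have "d = a" using a(3) a0 by (simp add: refl_form_def scaleR_2)
    ultimately show False using y fin_pos_minus[OF simple_fin_pos[OF a(1)]] by auto
  qed
  have "- (norm c * norm a) \<noteq> c \<bullet> a"
  proof
    assume "- (norm c * norm a) = c \<bullet> a"
    then have "norm (- c) *\<^sub>R a = norm a *\<^sub>R (- c)"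
      using norm_cauchy_schwarz_eq[of "- c" a] by simp
    \<comment> \<open>Dividing by \<open>norm a\<close> exhibits \<open>c\<close> as a multiple of
      \<open>a\<close>, the form in which reducedness applies.\<close>
    then have "(1 / norm a) *\<^sub>R (norm c *\<^sub>R a) = (1 / norm a) *\<^sub>R (norm a *\<^sub>R (- c))" by simp
    then have t: "(- (norm c / norm a)) *\<^sub>R a = c" using a0 by simp
    then have "- (norm c / norm a) = 1 \<or> - (norm c / norm a) = - 1"
      using red a\<Phi> c unfolding reduced_root_system_def by metis
    then show False
      using t \<open>c \<noteq> - a\<close> a(2) inner_ge_zero[of a] by (metis not_less scaleR_minus1_left scaleR_one)
  qed
  then have "- (norm c * norm a) < c \<bullet> a"
    using norm_cauchy_schwarz[of "- c" a] by simp
  moreover have "(c, k) \<noteq> (a, 0)" using a(2) inner_ge_zero[of a] by (metis not_less prod.inject)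
  ultimately show ?thesis
    unfolding short_cover_def using up_covers[OF fin_up_imp_up[OF up] x] a
    by (auto simp: aff_simple_eq fin_emb_def refl_aff_form aff_form_def aff_norm_def
        norm_eq_sqrt_inner intro!: bexI[of _ "(a, 0)"])
qed

end

theorem theorem4p4:
  fixes \<Phi>0 \<Delta>0 \<O> :: "'a::euclidean_space set" and \<omega> :: 'a
  assumes "crystallographic_root_system \<Phi>0"
    and "reduced_root_system \<Phi>0"
    and "irreducible_root_system \<Phi>0"
    and "simple_system \<Phi>0 \<Delta>0"
    and "highest_root \<Phi>0 \<Delta>0 \<omega>"
    and "\<exists>\<gamma>\<in>\<Phi>0. \<O> = fin_weyl_orbit \<Delta>0 \<gamma>"
  shows "bij_betw (\<lambda>\<alpha>. delta - \<alpha>) (orbit_pos \<Phi>0 \<Delta>0 \<O>) {delta - \<alpha> | \<alpha>. \<alpha> \<in> orbit_pos \<Phi>0 \<Delta>0 \<O>}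
    \<and> (\<forall>\<alpha>\<in>orbit_pos \<Phi>0 \<Delta>0 \<O>. \<forall>\<beta>\<in>orbit_pos \<Phi>0 \<Delta>0 \<O>.
          root_le \<Phi>0 \<Delta>0 \<omega> \<alpha> \<beta> \<longleftrightarrow> root_le \<Phi>0 \<Delta>0 \<omega> (delta - \<beta>) (delta - \<alpha>))
    \<and> (\<forall>\<alpha> \<beta>. covers_in (root_le \<Phi>0 \<Delta>0 \<omega>) (orbit_pos \<Phi>0 \<Delta>0 \<O>) \<alpha> \<beta>
          \<longrightarrow> short_cover \<Phi>0 \<Delta>0 \<omega> \<alpha> \<beta>)
    \<and> (\<forall>\<alpha> \<beta>. covers_in (root_le \<Phi>0 \<Delta>0 \<omega>) {delta - \<alpha> | \<alpha>. \<alpha> \<in> orbit_pos \<Phi>0 \<Delta>0 \<O>} \<alpha> \<beta>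
          \<longrightarrow> short_cover \<Phi>0 \<Delta>0 \<omega> \<alpha> \<beta>)"
proof -
  interpret affine_setting \<Phi>0 \<Delta>0 \<omega>
    using assms by unfold_locales
  from assms obtain \<gamma> where O: "\<O> = fin_weyl_orbit \<Delta>0 \<gamma>" by blast
  \<comment> \<open>Both posets are indexed by the same finite roots: \<open>c\<close> stands for
    \<open>(c, 0)\<close> in one and for \<open>(- c, 1)\<close> in the other.\<close>
  define P where "P = \<O> \<inter> fin_pos_roots \<Phi>0 \<Delta>0"
  have lower: "orbit_pos \<Phi>0 \<Delta>0 \<O> = (\<lambda>c. (c, 0)) ` P"
    by (simp add: orbit_pos_def P_def fin_emb_def)
  have upper: "{delta - \<alpha> | \<alpha>. \<alpha> \<in> orbit_pos \<Phi>0 \<Delta>0 \<O>} = (\<lambda>c. (- c, 1)) ` P"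
    unfolding lower by (auto simp: delta_def)
  have P_pos: "c \<in> fin_pos_roots \<Phi>0 \<Delta>0" if "c \<in> P" for c using that by (simp add: P_def)
  have P_chain: "d \<in> P" if "fin_up\<^sup>*\<^sup>* c d" "c \<in> P" for c d
    using fin_up_chain_positive[OF that(1)] fin_up_orbit[OF that(1)] that(2) by (simp add: P_def O)
  have lower_pos: "(c, 0) \<in> pos" and upper_pos: "(- c, 1) \<in> pos" if "c \<in> P" for c
    using P_pos[OF that] root_uminus highest(2)
    by (auto simp: fin_pos_roots_def aff_cone_iff)
  \<comment> \<open>Both orders become the same relation on \<open>P\<close>; the reversal comes
    from \<open>fin_up_chain_minus\<close>.\<close>
  have le_lower: "root_le \<Phi>0 \<Delta>0 \<omega> (c, 0) (d, 0) \<longleftrightarrow> fin_up\<^sup>*\<^sup>* c d" if "c \<in> P" "d \<in> P" for c d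
    using root_le_iff lower_pos that up_chain_iff by simp
  have le_upper: "root_le \<Phi>0 \<Delta>0 \<omega> (- d, 1) (- c, 1) \<longleftrightarrow> fin_up\<^sup>*\<^sup>* c d" if "c \<in> P" "d \<in> P" for c d
    using root_le_iff upper_pos that up_chain_iff fin_up_chain_minus by simp
  have "short_cover \<Phi>0 \<Delta>0 \<omega> x y"
    if cov: "covers_in (root_le \<Phi>0 \<Delta>0 \<omega>) ((\<lambda>c. (c, 0)) ` P) x y" for x y
  proof -
    from cov obtain c d where cd: "x = (c, 0)" "y = (d, 0)" "c \<in> P" "d \<in> P" "c \<noteq> d"
      unfolding covers_in_def by auto
    then have "fin_up\<^sup>*\<^sup>* c d" using cov le_lower by (auto simp: covers_in_def)
    \<comment> \<open>The end \<open>e\<close> of the first step lies between \<open>c\<close> and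
      \<open>d\<close> and differs from \<open>c\<close>, so the cover forces
      \<open>e = d\<close>.\<close>
    then obtain e where e: "fin_up c e" "fin_up\<^sup>*\<^sup>* e d"
      using cd(5) by (auto elim: converse_rtranclpE)
    then have "e \<in> P" using P_chain[of c e] cd(3) by auto
    moreover from this have "root_le \<Phi>0 \<Delta>0 \<omega> x (e, 0)" "root_le \<Phi>0 \<Delta>0 \<omega> (e, 0) y"
      using e le_lower cd by auto
    ultimately have "(e, 0) = x \<or> (e, 0) = y" using cov unfolding covers_in_def by blast
    then have "e = d" using fin_up_ne[OF e(1)] cd by auto
    then show ?thesis using short_coverI[OF e(1) lower_pos] P_pos cd by simp
  qed
  moreover have "short_cover \<Phi>0 \<Delta>0 \<omega> x y"
    if cov: "covers_in (root_le \<Phi>0 \<Delta>0 \<omega>) ((\<lambda>c. (- c, 1)) ` P) x y" for x y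
  proof -
    from cov obtain c d where cd: "x = (- d, 1)" "y = (- c, 1)" "c \<in> P" "d \<in> P" "c \<noteq> d"
      unfolding covers_in_def by auto
    then have "fin_up\<^sup>*\<^sup>* c d" using cov le_upper by (auto simp: covers_in_def)
    \<comment> \<open>Negation turns the last step of this chain into the first step up from
      \<open>x\<close>, so the chain is split at its end.\<close>
    then obtain e where e: "fin_up\<^sup>*\<^sup>* c e" "fin_up e d"
      using cd(5) by (auto elim: rtranclp.cases)
    then have eP: "e \<in> P" using P_chain[of c e] cd(3) by auto
    then have "root_le \<Phi>0 \<Delta>0 \<omega> x (- e, 1)" "root_le \<Phi>0 \<Delta>0 \<omega> (- e, 1) y"
      using e le_upper cd by auto
    with eP have "(- e, 1) = x \<or> (- e, 1) = y" using cov unfolding covers_in_def by blast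
    then have "e = c" using fin_up_ne[OF e(2)] cd by auto
    then show ?thesis using short_coverI[OF fin_up_minus[OF e(2)] upper_pos] P_pos cd by simp
  qed
  moreover have "bij_betw (\<lambda>\<alpha>. delta - \<alpha>) (orbit_pos \<Phi>0 \<Delta>0 \<O>)
      {delta - \<alpha> | \<alpha>. \<alpha> \<in> orbit_pos \<Phi>0 \<Delta>0 \<O>}"
    by (auto simp: bij_betw_def inj_on_def)
  moreover have "root_le \<Phi>0 \<Delta>0 \<omega> \<alpha> \<beta> \<longleftrightarrow> root_le \<Phi>0 \<Delta>0 \<omega> (delta - \<beta>) (delta - \<alpha>)"
    if "\<alpha> \<in> orbit_pos \<Phi>0 \<Delta>0 \<O>" "\<beta> \<in> orbit_pos \<Phi>0 \<Delta>0 \<O>" for \<alpha> \<beta>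
    using that le_lower le_upper unfolding lower by (auto simp: delta_def)
  \<comment> \<open>\<open>upper\<close> goes first, because its left side contains
    \<open>orbit_pos\<close>, which \<open>lower\<close> rewrites.\<close>
  ultimately show ?thesis unfolding upper unfolding lower by blast
qed

end
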